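(* For every integer $k\geq 1$, the median hypersimplex $\Delta_{2k,k}$ is Minkowski indecomposable. That is, whenever $\lambda\Delta_{2k,k}=Q+R$ with $\lambda>0$ and $Q,R$ convex polytopes, both $Q$ and $R$ are homothetic translates of $\Delta_{2k,k}$.
   Context: For integers $n$ and $r$, the hypersimplex $\Delta_{n,r}\subset\mathbb{R}^n$ is the convex hull of all vertices of the cube $[0,1]^n$ (i.e. $0/1$-vectors) that lie on the hyperplane $x_1+\dots+x_n=r$. The hypersimplex $\Delta_{2k,k}$ is called the median hypersimplex. The sum $Q+R=\{q+r \mid q\in Q,\ r\in R\}$ is the Minkowski sum. A polytope $Q$ is a homothetic translate of $P$ if $Q=\mu P+v$ for some real $\mu\geq 0$ and some vector $v$ (the case $\mu=0$, a single point, is allowed). *)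

theory Defs
  imports "HOL-Analysis.Analysis"
begin

text \<open>The ambient space \<open>real ^ 'n\<close> has dimension \<open>n = CARD('n)\<close>; the 0/1-vectors are the
  vertices of the cube.\<close>

definition hypersimplex :: "int \<Rightarrow> (real ^ 'n::finite) set" where
  "hypersimplex r =
     convex hull {x. (\<forall>i. x $ i \<in> {0, 1}) \<and> (\<Sum>i\<in>UNIV. x $ i) = real_of_int r}"

definition homothetic_translate :: "'a::real_vector set \<Rightarrow> 'a set \<Rightarrow> bool" where
  "homothetic_translate Q P \<longleftrightarrow> (\<exists>\<mu>\<ge>0. \<exists>v. Q = (\<lambda>x. \<mu> *\<^sub>R x + v) ` P)"

text \<open>On sets, \<open>+\<close> is the Minkowski sum of \<^theory>\<open>HOL-Library.Set_Algebras\<close>. The empty set counts as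
  a \<^const>\<open>polytope\<close> in the library, but it cannot occur as a summand of a nonempty set.\<close>

definition minkowski_indecomposable :: "'a::real_normed_vector set \<Rightarrow> bool" where
  "minkowski_indecomposable P \<longleftrightarrow>
     (\<forall>c>0. \<forall>Q R. polytope Q \<longrightarrow> polytope R \<longrightarrow> (\<lambda>x. c *\<^sub>R x) ` P = Q + R \<longrightarrow>
        homothetic_translate Q P \<and> homothetic_translate R P)"

end

theory Submission imports Defs begin

text \<open>If \<open>c *\<^sub>R v = q v + r v\<close> for each vertex \<open>v\<close>, then \<open>q v\<close> maximises over \<open>Q\<close> every linear functional
  that \<open>v\<close> maximises over the hypersimplex. Applied to \<open>\<plusminus>x\<^sub>l\<close>, this shows that the coordinate
  \<open>(q v)\<^sub>l\<close> depends only on whether \<open>v\<^sub>l\<close> is 0 or 1; applied to \<open>\<Sum>\<^sub>l x\<^sub>l\<close>, that the coordinate sum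
  of \<open>q v\<close> is constant. Exchanging one element of the support of \<open>v\<close> then forces all coordinates to
  jump by the same amount \<open>d\<close>, so \<open>q v = m + d *\<^sub>R v\<close>; and \<open>Q\<close> is the convex hull of the \<open>q v\<close>,
  since these maximise every linear functional.\<close>

definition hypersimplex_vertices :: "nat \<Rightarrow> (real ^ 'n::finite) set" where
  "hypersimplex_vertices k = {x. (\<forall>i. x $ i \<in> {0, 1}) \<and> (\<Sum>i\<in>UNIV. x $ i) = real k}"

lemma hypersimplex_eq_hull: "hypersimplex (int k) = convex hull (hypersimplex_vertices k)"
  by (simp add: hypersimplex_def hypersimplex_vertices_def)

lemma finite_hypersimplex_vertices:
  "finite (hypersimplex_vertices k :: (real ^ 'n::finite) set)"
proof -
  have "hypersimplex_vertices k \<subseteq> (\<lambda>S. \<chi> i. indicator S i) ` (UNIV :: 'n set set)"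
  proof
    fix x :: "real ^ 'n" assume "x \<in> hypersimplex_vertices k"
    then have "x = (\<chi> i. indicator {i. x $ i = 1} i)"
      by (auto simp: hypersimplex_vertices_def vec_eq_iff indicator_def)
    then show "x \<in> (\<lambda>S. \<chi> i. indicator S i) ` UNIV" by blast
  qed
  then show ?thesis by (rule finite_subset) simp
qed

lemma indicator_in_hypersimplex_vertices:
  assumes "card S = k"
  shows "(\<chi> i. indicator S i) \<in> (hypersimplex_vertices k :: (real ^ 'n::finite) set)"
  using assms by (auto simp: hypersimplex_vertices_def indicator_def sum.If_cases)

text \<open>For \<open>y\<close> in \<open>Q\<close>, the point \<open>y + r\<close> lies in the
  scaled hull, where \<open>a\<close> is at most
  \<open>c * (a \<bullet> v) = a \<bullet> q + a \<bullet> r\<close>; cancel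
  \<open>a \<bullet> r\<close>.\<close>

lemma summand_maximiser:
  fixes V Q R :: "'a::real_inner set"
  assumes "c \<ge> 0" and dec: "(\<lambda>x. c *\<^sub>R x) ` (convex hull V) = Q + R"
    and "v \<in> V" and opt: "\<And>w. w \<in> V \<Longrightarrow> a \<bullet> w \<le> a \<bullet> v"
    and "r \<in> R" "c *\<^sub>R v = q + r" and "y \<in> Q"
  shows "a \<bullet> y \<le> a \<bullet> q"
proof -
  have "y + r \<in> (\<lambda>x. c *\<^sub>R x) ` (convex hull V)"
    unfolding dec using assms by (auto simp: set_plus_def)
  then obtain z where z: "z \<in> convex hull V" "y + r = c *\<^sub>R z" by auto
  have "convex hull V \<subseteq> {z. a \<bullet> z \<le> a \<bullet> v}"
    using opt by (intro hull_minimal convex_halfspace_le) auto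
  then have "c * (a \<bullet> z) \<le> c * (a \<bullet> v)"
    using z \<open>c \<ge> 0\<close> by (intro mult_left_mono) auto
  then have "a \<bullet> (y + r) \<le> a \<bullet> (q + r)"
    unfolding z(2) \<open>c *\<^sub>R v = q + r\<close>[symmetric] by simp
  then show ?thesis by (simp add: inner_add_right)
qed

text \<open>A point of \<open>Q\<close> outside the hull is strictly separated from it by some
  \<open>a\<close>; yet the vertex \<open>v\<close> minimising \<open>a\<close> yields a
  \<open>q v\<close> that minimises \<open>a\<close> over all of \<open>Q\<close>.\<close>

lemma summand_eq_hull_maximisers:
  fixes V Q R :: "'a::euclidean_space set"
  assumes "c \<ge> 0" and dec: "(\<lambda>x. c *\<^sub>R x) ` (convex hull V) = Q + R"
    and "convex Q" and V: "finite V" "V \<noteq> {}"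
    and qr: "\<And>v. v \<in> V \<Longrightarrow> q v \<in> Q \<and> r v \<in> R \<and> c *\<^sub>R v = q v + r v"
  shows "Q = convex hull (q ` V)"
proof (rule antisym)
  show "convex hull (q ` V) \<subseteq> Q"
    using qr \<open>convex Q\<close> by (intro hull_minimal) auto
  show "Q \<subseteq> convex hull (q ` V)"
  proof (rule ccontr)
    assume "\<not> ?thesis"
    then obtain y where y: "y \<in> Q" "y \<notin> convex hull (q ` V)" by blast
    have "closed (convex hull (q ` V))"
      using V by (intro compact_imp_closed finite_imp_compact_convex_hull) auto
    then obtain a b where ab: "a \<bullet> y < b" "\<And>x. x \<in> convex hull (q ` V) \<Longrightarrow> b < a \<bullet> x"
      using separating_hyperplane_closed_point[OF convex_convex_hull _ y(2)] by blast
    obtain v where v: "v \<in> V" "\<And>w. w \<in> V \<Longrightarrow> a \<bullet> v \<le> a \<bullet> w"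
      using ex_min_if_finite[of "(\<lambda>w. a \<bullet> w) ` V"] V
      by (auto simp: not_less)
    have "(- a) \<bullet> y \<le> (- a) \<bullet> q v"
      using summand_maximiser[OF assms(1) dec v(1), of "- a" "r v" "q v" y] v(2) qr[OF v(1)] y(1)
      by simp
    moreover have "b < a \<bullet> q v"
      using v(1) by (intro ab(2) hull_inc) auto
    ultimately show False using ab(1) by simp
  qed
qed

text \<open>The bounds on \<open>k\<close> ensure that every coordinate takes both values 0 and 1 on
  the vertices and that any two indices can be exchanged.\<close>

lemma hypersimplex_summand:
  fixes Q R :: "(real ^ 'n::finite) set"
  assumes k: "0 < k" "k < CARD('n)" and "c \<ge> 0" and "convex Q"
    and "(\<lambda>x. c *\<^sub>R x) ` hypersimplex (int k) = Q + R"
  shows "homothetic_translate Q (hypersimplex (int k))"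
proof -
  define V where "V = (hypersimplex_vertices k :: (real ^ 'n) set)"
  have dec: "(\<lambda>x. c *\<^sub>R x) ` (convex hull V) = Q + R"
    using assms(5) by (simp add: V_def hypersimplex_eq_hull)
  have V01: "v $ l = 0 \<or> v $ l = 1" and Vsum: "(\<Sum>l\<in>UNIV. v $ l) = real k"
    if "v \<in> V" for v l
    using that by (auto simp: V_def hypersimplex_vertices_def)
  have "\<forall>v\<in>V. \<exists>q r. q \<in> Q \<and> r \<in> R \<and> c *\<^sub>R v = q + r"
  proof
    fix v assume "v \<in> V"
    then have "c *\<^sub>R v \<in> Q + R" unfolding dec[symmetric] by (intro imageI hull_inc)
    then show "\<exists>q r. q \<in> Q \<and> r \<in> R \<and> c *\<^sub>R v = q + r" by (auto simp: set_plus_def)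
  qed
  then obtain q r where qr: "\<And>v. v \<in> V \<Longrightarrow> q v \<in> Q \<and> r v \<in> R \<and> c *\<^sub>R v = q v + r v"
    by metis
  have max: "a \<bullet> q w \<le> a \<bullet> q v" if "v \<in> V" "w \<in> V" "\<And>u. u \<in> V \<Longrightarrow> a \<bullet> u \<le> a \<bullet> v" for a v w
    using summand_maximiser[OF \<open>c \<ge> 0\<close> dec that(1) that(3), of "r v" "q v" "q w"]
      qr[OF that(1)] qr[OF that(2)] by blast
  \<comment> \<open>Either \<open>v\<close> maximises the \<open>l\<close>-th coordinate, or both
    entries are 0 and \<open>w\<close> minimises it. If the entries agree, using this in both
    directions gives equality.\<close>
  have mono: "q w $ l \<le> q v $ l" if "v \<in> V" "w \<in> V" "w $ l \<le> v $ l" for v w l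
  proof (cases "v $ l = 1")
    case True
    have "u $ l \<le> 1" if "u \<in> V" for u using V01[OF that, of l] by auto
    then show ?thesis
      using max[OF that(1,2), of "axis l 1"] True by (simp add: inner_axis')
  next
    case False
    then have "w $ l = 0" using that V01[of v l] V01[of w l] by auto
    moreover have "0 \<le> u $ l" if "u \<in> V" for u using V01[OF that, of l] by auto
    ultimately show ?thesis
      using max[OF that(2,1), of "- axis l 1"] by (simp add: inner_axis')
  qed
  \<comment> \<open>All vertices have coordinate sum \<open>k\<close>, so each of them maximises the
    all-ones functional.\<close>
  have sum_q: "(\<Sum>l\<in>UNIV. q v $ l) = (\<Sum>l\<in>UNIV. q w $ l)" if "v \<in> V" "w \<in> V" for v w
  proof -
    have "(\<chi> l. 1) \<bullet> q v = (\<chi> l. 1) \<bullet> q w"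
      using that by (intro antisym max) (auto simp: inner_vec_def Vsum)
    then show ?thesis by (simp add: inner_vec_def)
  qed

  have exchange: "\<exists>T. i \<notin> T \<and> j \<notin> T \<and> (\<chi> l. indicator (insert i T) l) \<in> V
      \<and> (\<chi> l. indicator (insert j T) l) \<in> V" if "i \<noteq> j" for i j :: 'n
  proof -
    \<comment> \<open>Room for the common part \<open>T\<close> of the two supports:
      \<open>k - 1\<close> indices out of the \<open>CARD('n) - 2\<close> other than
      \<open>i\<close> and \<open>j\<close>.\<close>
    have "k - 1 \<le> card (UNIV - {i, j})" using k that by (simp add: card_Diff_subset)
    then obtain T where T: "T \<subseteq> UNIV - {i, j}" "card T = k - 1"
      using obtain_subset_with_card_n by metis
    then have "card (insert i T) = k" "card (insert j T) = k"
      using k by (auto simp: card_insert_if)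
    then show ?thesis
      using T by (auto simp: V_def intro!: exI[of _ T] indicator_in_hypersimplex_vertices)
  qed
  have "\<exists>u v. u \<in> V \<and> v \<in> V \<and> u $ l = 1 \<and> v $ l = 0" for l
  proof -
    obtain j where "l \<noteq> j"
      using k by (metis UNIV_eq_I card_1_singleton_iff not_less_eq singletonI)
    then obtain T where "l \<notin> T" "(\<chi> i. indicator (insert l T) i) \<in> V"
      "(\<chi> i. indicator (insert j T) i) \<in> V"
      using exchange by blast
    with \<open>l \<noteq> j\<close> show ?thesis
      by (intro exI[of _ "\<chi> i. indicator (insert l T) i"]
          exI[of _ "\<chi> i. indicator (insert j T) i"]) (simp add: indicator_def)
  qed
  then obtain p0 p1 where p: "\<And>l. p1 l \<in> V" "\<And>l. p0 l \<in> V" "\<And>l. p1 l $ l = 1" "\<And>l. p0 l $ l = 0"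
    by metis
  \<comment> \<open>\<open>m\<close> collects the values at entry 0, each coordinate from its own
    reference vertex \<open>p0 l\<close>; \<open>d l\<close> is the jump from entry 0 to entry
    1.\<close>
  define m :: "real ^ 'n" where "m = (\<chi> l. q (p0 l) $ l)"
  define d where "d l = q (p1 l) $ l - m $ l" for l
  have q_eq: "q v $ l = m $ l + v $ l * d l" if "v \<in> V" for v l
    using V01[OF that, of l] p[of l] that mono[of v "p0 l" l] mono[of "p0 l" v l]
      mono[of v "p1 l" l] mono[of "p1 l" v l]
    by (auto simp: m_def d_def)
  have d_nonneg: "d l \<ge> 0" for l
    using mono[OF p(1,2), of l l l] p(3,4)[of l] by (simp add: m_def d_def)
  have d_eq: "d i = d j" for i j
  proof (cases "i = j")
    case False
    then obtain T where T: "i \<notin> T" "j \<notin> T" "(\<chi> l. indicator (insert i T) l) \<in> V"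
      "(\<chi> l. indicator (insert j T) l) \<in> V"
      using exchange by blast
    \<comment> \<open>For the supports \<open>insert i T\<close> and \<open>insert j T\<close> these
      sums agree by \<open>sum_q\<close>; cancelling \<open>sum d T\<close> leaves
      \<open>d i = d j\<close>.\<close>
    have sum_ind: "(\<Sum>l\<in>UNIV. q (\<chi> l. indicator S l) $ l) = (\<Sum>l\<in>UNIV. m $ l) + sum d S"
      if "(\<chi> l. indicator S l) \<in> V" for S
      using q_eq[OF that] by (simp add: sum.distrib)
    show ?thesis
      using sum_q[OF T(3,4)] sum_ind[OF T(3)] sum_ind[OF T(4)] T(1,2) by simp
  qed simp
  obtain \<mu> where \<mu>: "\<And>l. d l = \<mu>" "\<mu> \<ge> 0"
    using d_eq d_nonneg by metis
  have "q v = m + \<mu> *\<^sub>R v" if "v \<in> V" for v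
    using q_eq[OF that] \<mu> by (simp add: vec_eq_iff mult.commute)
  then have "q ` V = (\<lambda>x. m + \<mu> *\<^sub>R x) ` V" by simp
  moreover have "V \<noteq> {}" using p(1) by blast
  moreover have "finite V" by (simp add: V_def finite_hypersimplex_vertices)
  ultimately have "Q = (\<lambda>x. m + \<mu> *\<^sub>R x) ` (convex hull V)"
    using summand_eq_hull_maximisers[OF \<open>c \<ge> 0\<close> dec \<open>convex Q\<close> _ _ qr]
    by (simp add: convex_hull_affinity)
  then show ?thesis
    using \<open>\<mu> \<ge> 0\<close> unfolding homothetic_translate_def hypersimplex_eq_hull V_def
    by (metis (no_types, lifting) add.commute image_cong)
qed

theorem theorem3p10:
  fixes k :: nat
  assumes "k \<ge> 1" and "CARD('n::finite) = 2 * k"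
  shows "minkowski_indecomposable (hypersimplex (int k) :: (real ^ 'n) set)"
  unfolding minkowski_indecomposable_def
proof (intro allI impI)
  fix c :: real and Q R :: "(real ^ 'n) set"
  assume "c > 0" "polytope Q" "polytope R"
    and dec: "(\<lambda>x. c *\<^sub>R x) ` hypersimplex (int k) = Q + R"
  \<comment> \<open>The summands play symmetric roles, so the same lemma also handles
    \<open>R\<close>.\<close>
  moreover have "(\<lambda>x. c *\<^sub>R x) ` hypersimplex (int k) = R + Q"
    using dec by (simp add: add.commute)
  moreover have "0 < k" "k < CARD('n)" using assms by auto
  ultimately show "homothetic_translate Q (hypersimplex (int k))
      \<and> homothetic_translate R (hypersimplex (int k))"
    by (meson hypersimplex_summand less_imp_le polytope_imp_convex)
qed

end
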